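(* Let $p\in(0,1)$ and let $d$ be a positive integer. The expected value of $X\sim\mathrm{TG}_{p,d}$ is $$\frac{1-p-(1-p)^{d+1}-dp(1-p)^d}{p(1-(1-p)^d)}.$$
   Context: For a positive integer $s$ and $p\in(0,1)$, the truncated geometric distribution $\mathrm{TG}_{p,s}$ is the distribution on $\{0,1,\dots,s-1\}$ with $\Pr[X=k]=p(1-p)^k/[1-(1-p)^s]$ for all $0\le k\le s-1$. *)

theory Defs
  imports "HOL-Probability.Probability"
begin

text \<open>
  The truncated geometric distribution on \<open>{0..<s}\<close>, for \<open>0 < p < 1\<close> and \<open>s > 0\<close>.
  Since \<^const>\<open>embed_pmf\<close> is only meaningful for a normalised mass function, the lemma
  \<open>pmf_trunc_geometric\<close> below confirms that it applies in this parameter range.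
\<close>

definition trunc_geometric_pmf :: "real \<Rightarrow> nat \<Rightarrow> nat pmf" where
  "trunc_geometric_pmf p s =
     embed_pmf (\<lambda>k. if k < s then p * (1 - p) ^ k / (1 - (1 - p) ^ s) else 0)"

lemma pmf_trunc_geometric:
  assumes p: "0 < p" "p < 1" and s: "0 < s"
  shows "pmf (trunc_geometric_pmf p s) k =
           (if k < s then p * (1 - p) ^ k / (1 - (1 - p) ^ s) else 0)"
proof -
  let ?f = "\<lambda>k. if k < s then p * (1 - p) ^ k / (1 - (1 - p) ^ s) else 0"
  have lt1: "(1 - p) ^ s < 1"
    using p s by (simp add: power_less_one_iff)
  have nonneg: "0 \<le> ?f k" for k
    using p lt1 by auto
  have "(\<Sum>k<s. p * (1 - p) ^ k) = 1 - (1 - p) ^ s"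
    using p by (simp add: sum_distrib_left[symmetric] sum_gp_strict)
  then have sum1: "(\<Sum>k<s. ?f k) = 1"
    using lt1 by (simp add: sum_divide_distrib[symmetric])
  have "(\<integral>\<^sup>+ k. ennreal (?f k) \<partial>count_space UNIV) = (\<integral>\<^sup>+ k. ennreal (?f k) \<partial>count_space {..<s})"
    by (rule nn_integral_count_space_eq) auto
  also have "\<dots> = (\<Sum>k<s. ennreal (?f k))"
    by (simp add: nn_integral_count_space_finite)
  also have "\<dots> = ennreal (\<Sum>k<s. ?f k)"
    by (rule sum_ennreal) (use nonneg in blast)
  also have "\<dots> = 1"
    using sum1 by simp
  finally show ?thesis
    unfolding trunc_geometric_pmf_def using nonneg by (subst pmf_embed_pmf) auto
qed

end

theory Submission
  imports Defs
begin

text \<open>The support is finite, so the expectation is an arithmetic-geometric sum over the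
  constant \<open>1 - (1 - p) ^ d\<close>. \<open>sum_of_nat_times_power\<close> evaluates
  \<open>p\<close> times that sum.\<close>

text \<open>The leading factor \<open>p\<close> clears the denominator of the usual closed form.
  Both sides are then polynomials in \<open>p\<close>, and induction on \<open>d\<close> needs only
  ring algebra.\<close>

lemma sum_of_nat_times_power:
  fixes p :: "'a :: comm_ring_1"
  shows "p * (\<Sum>k<d. of_nat k * (p * (1 - p) ^ k)) =
           1 - p - (1 - p) ^ (d + 1) - of_nat d * p * (1 - p) ^ d"
  by (induction d) (simp_all add: algebra_simps)

theorem lemma3:
  fixes p :: real and d :: nat
  assumes "0 < p" and "p < 1" and "0 < d"
  shows "measure_pmf.expectation (trunc_geometric_pmf p d) (\<lambda>k. real k) =
           (1 - p - (1 - p) ^ (d + 1) - real d * p * (1 - p) ^ d) / (p * (1 - (1 - p) ^ d))"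
proof -
  note pmf = pmf_trunc_geometric[OF assms]
  have "set_pmf (trunc_geometric_pmf p d) \<subseteq> {..<d}"
    by (auto simp: set_pmf_eq pmf split: if_splits)
  then have "measure_pmf.expectation (trunc_geometric_pmf p d) real =
      (\<Sum>k<d. pmf (trunc_geometric_pmf p d) k * real k)"
    by (subst integral_measure_pmf[of "{..<d}"]) auto
  also have "\<dots> = (\<Sum>k<d. real k * (p * (1 - p) ^ k)) / (1 - (1 - p) ^ d)"
    by (simp add: pmf sum_divide_distrib mult_ac)
  \<comment> \<open>Expanding by \<open>p\<close>, nonzero by assumption, creates the left side of
    \<open>sum_of_nat_times_power\<close>.\<close>
  also have "\<dots> = (p * (\<Sum>k<d. real k * (p * (1 - p) ^ k))) / (p * (1 - (1 - p) ^ d))"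
    using assms by simp
  finally show ?thesis
    by (simp only: sum_of_nat_times_power)
qed

end
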